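(* Let $\Phi\in\{B_n,C_n,D_n\}$ and fix any $\mathbf s\in{\rm Score}(\Phi)$. Then the Coxeter interchange graph ${\rm IntGr}(\Phi,\mathbf s)$ is connected and its diameter (maximal graph distance between two vertices) is $O(n^2)$, with implied constant independent of $n$ and $\mathbf s$.
   Context: Signed graphs. Let $[n]=\{1,\dots,n\}$ and let $\mathbf e_1,\dots,\mathbf e_n$ be the standard basis of $\mathbb R^n$. A signed graph on $[n]$ has signed edges of four kinds: negative edges $e^-_{ij}$ and positive edges $e^+_{ij}$ between distinct vertices $i,j$, half edges $e^h_i$ and loops $e^\ell_i$ at a vertex $i$. Vectors: $\mathbf e^{\pm}_{ij}=\mathbf e_i\pm\mathbf e_j$ (for $i>j$), $\mathbf e^h_i=\mathbf e_i$, $\mathbf e^\ell_i=2\mathbf e_i$. $\mathcal K_{D_n}$ contains all negative and positive edges (one of each per pair); $\mathcal K_{B_n}$ contains these plus all half edges; $\mathcal K_{C_n}$ contains all negative and positive edges plus all loops. A Coxeter tournament $\mathcal T$ on a signed graph $\mathcal S$ is a family $(w_e)_{e\in E(\mathcal S)}$, $w_e\in\{0,1\}$ (edges are "games"); its score sequence is $\mathbf s(\mathcal T)=\sum_e(w_e-\frac12)\mathbf e$. A sub-tournament is the restriction to a subset of games; it is neutral if the corresponding sum over its games is $\mathbf 0$. $\mathcal T*\mathcal X$ flips $w_e\mapsto1-w_e$ for the games $e$ of $\mathcal X\subseteq\mathcal T$. ${\rm Score}(\Phi)$ is the set of score sequences of tournaments on $\mathcal K_\Phi$; ${\rm Tour}(\Phi,\mathbf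 s)$ the set of tournaments on $\mathcal K_\Phi$ with score $\mathbf s$. A copy of a type-$\Phi$ generator in $\mathcal T$ is a neutral sub-tournament whose games are: (a) (all types) three negative edges pairwise joining three distinct vertices, or one negative and two positive edges pairwise joining three distinct vertices (one edge per pair); (b) (only $B_n$) a negative or positive edge between $i\ne j$ plus half edges $e^h_i,e^h_j$; (c) (only $C_n$, "neutral clover") $e^-_{ij},e^+_{ij},e^\ell_i$. ${\rm IntGr}(\Phi,\mathbf s)$ is the multigraph on ${\rm Tour}(\Phi,\mathbf s)$ where $\mathcal T_1,\mathcal T_2$ are joined iff $\mathcal T_2=\mathcal T_1*\mathcal G$ for a copy $\mathcal G$ of a type-$\Phi$ generator in $\mathcal T_1$, by a double edge if $\mathcal G$ is a neutral clover and a single edge otherwise. *)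

theory Defs
  imports "Graph_Theory.Graph_Theory" "HOL-Library.FuncSet"
begin

text \<open>
  An edge between distinct vertices i and j is stored with its larger endpoint first, so that
  the sign of the vector of a negative edge is determined: use \<open>neg_edge\<close> and \<open>pos_edge\<close> to
  refer to the edge joining an unordered pair.
\<close>

datatype sedge = Neg nat nat | Pos nat nat | Half nat | Loop nat

definition neg_edge :: "nat \<Rightarrow> nat \<Rightarrow> sedge" where
  "neg_edge i j = Neg (max i j) (min i j)"

definition pos_edge :: "nat \<Rightarrow> nat \<Rightarrow> sedge" where
  "pos_edge i j = Pos (max i j) (min i j)"

text \<open>
  Vectors in \<open>\<real>\<^sup>n\<close> are functions on \<open>nat\<close> that vanish outside \<open>{1..n}\<close>. All vectors below are
  combinations of the \<open>basis_vec i\<close> with \<open>i \<in> {1..n}\<close>, hence have this form.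
\<close>

definition basis_vec :: "nat \<Rightarrow> nat \<Rightarrow> real" where
  "basis_vec i = (\<lambda>k. if k = i then 1 else 0)"

primrec edge_vec :: "sedge \<Rightarrow> nat \<Rightarrow> real" where
  "edge_vec (Neg i j) = (\<lambda>k. basis_vec i k - basis_vec j k)"
| "edge_vec (Pos i j) = (\<lambda>k. basis_vec i k + basis_vec j k)"
| "edge_vec (Half i) = basis_vec i"
| "edge_vec (Loop i) = (\<lambda>k. 2 * basis_vec i k)"

datatype coxeter_type = Type_B | Type_C | Type_D

definition pair_edges :: "nat \<Rightarrow> sedge set" where
  "pair_edges n = {Neg i j | i j. 1 \<le> j \<and> j < i \<and> i \<le> n} \<union> {Pos i j | i j. 1 \<le> j \<and> j < i \<and> i \<le> n}"

primrec complete_sgraph :: "coxeter_type \<Rightarrow> nat \<Rightarrow> sedge set" where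
  "complete_sgraph Type_B n = pair_edges n \<union> Half ` {1..n}"
| "complete_sgraph Type_C n = pair_edges n \<union> Loop ` {1..n}"
| "complete_sgraph Type_D n = pair_edges n"

definition tournaments :: "sedge set \<Rightarrow> (sedge \<Rightarrow> nat) set" where
  "tournaments E = E \<rightarrow>\<^sub>E {0, 1}"

text \<open>
  The contribution of the games in \<open>X\<close> to the score; for the whole edge set this is the score
  sequence. A sub-tournament is identified with its set of games.
\<close>

definition score :: "sedge set \<Rightarrow> (sedge \<Rightarrow> nat) \<Rightarrow> nat \<Rightarrow> real" where
  "score X w = (\<lambda>k. \<Sum>e\<in>X. (real (w e) - 1/2) * edge_vec e k)"

definition neutral :: "(sedge \<Rightarrow> nat) \<Rightarrow> sedge set \<Rightarrow> bool" where
  "neutral w X \<longleftrightarrow> score X w = (\<lambda>k. 0)"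

definition flip :: "(sedge \<Rightarrow> nat) \<Rightarrow> sedge set \<Rightarrow> sedge \<Rightarrow> nat" where
  "flip w X = (\<lambda>e. if e \<in> X then 1 - w e else w e)"

definition Score :: "coxeter_type \<Rightarrow> nat \<Rightarrow> (nat \<Rightarrow> real) set" where
  "Score \<Phi> n = score (complete_sgraph \<Phi> n) ` tournaments (complete_sgraph \<Phi> n)"

definition Tour :: "coxeter_type \<Rightarrow> nat \<Rightarrow> (nat \<Rightarrow> real) \<Rightarrow> (sedge \<Rightarrow> nat) set" where
  "Tour \<Phi> n s = {w \<in> tournaments (complete_sgraph \<Phi> n). score (complete_sgraph \<Phi> n) w = s}"

definition triangle :: "sedge set \<Rightarrow> bool" where
  "triangle X \<longleftrightarrow> (\<exists>i j k. i \<noteq> j \<and> j \<noteq> k \<and> i \<noteq> k \<and>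
     (X = {neg_edge i j, neg_edge j k, neg_edge i k} \<or>
      X = {neg_edge i j, pos_edge j k, pos_edge i k}))"

definition half_edge_triangle :: "sedge set \<Rightarrow> bool" where
  "half_edge_triangle X \<longleftrightarrow> (\<exists>i j. i \<noteq> j \<and>
     (X = {neg_edge i j, Half i, Half j} \<or> X = {pos_edge i j, Half i, Half j}))"

definition clover :: "sedge set \<Rightarrow> bool" where
  "clover X \<longleftrightarrow> (\<exists>i j. i \<noteq> j \<and> X = {neg_edge i j, pos_edge i j, Loop i})"

definition generator_copy :: "coxeter_type \<Rightarrow> nat \<Rightarrow> (sedge \<Rightarrow> nat) \<Rightarrow> sedge set \<Rightarrow> bool" where
  "generator_copy \<Phi> n w X \<longleftrightarrow> X \<subseteq> complete_sgraph \<Phi> n \<and> neutral w X \<and>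
     (triangle X \<or> \<Phi> = Type_B \<and> half_edge_triangle X \<or> \<Phi> = Type_C \<and> clover X)"

text \<open>
  The interchange multigraph as a symmetric multi-digraph: every undirected edge is a pair of
  opposite arcs. The third component of an arc numbers the parallel copies, of which there are two
  for a clover and one otherwise; distinct \<open>X\<close> lead from \<open>w\<close> to distinct tournaments.
\<close>

definition IntGr :: "coxeter_type \<Rightarrow> nat \<Rightarrow> (nat \<Rightarrow> real) \<Rightarrow>
    (sedge \<Rightarrow> nat, (sedge \<Rightarrow> nat) \<times> sedge set \<times> nat) pre_digraph" where
  "IntGr \<Phi> n s = \<lparr>
     verts = Tour \<Phi> n s,
     arcs = {(w, X, m). w \<in> Tour \<Phi> n s \<and> generator_copy \<Phi> n w X \<and> m < (if clover X then 2 else 1)},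
     tail = (\<lambda>(w, X, m). w),
     head = (\<lambda>(w, X, m). flip w X)\<rparr>"

text \<open>The weight of every arc is 1, so \<open>\<mu>\<close> is the minimal number of arcs of a walk.\<close>

definition graph_diameter :: "('a, 'b) pre_digraph \<Rightarrow> ereal" where
  "graph_diameter G = (SUP u\<in>verts G. SUP v\<in>verts G. wf_digraph.\<mu> G (\<lambda>_. 1) u v)"

lemma finite_complete_sgraph: "finite (complete_sgraph \<Phi> n)"
proof -
  have "pair_edges n \<subseteq> (\<lambda>(i, j). Neg i j) ` ({..n} \<times> {..n}) \<union> (\<lambda>(i, j). Pos i j) ` ({..n} \<times> {..n})"
    by (auto simp: pair_edges_def image_iff)
  then have "finite (pair_edges n)"
    by (rule finite_subset) auto
  then show ?thesis by (cases \<Phi>) auto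
qed

lemma tournaments_value:
  assumes "w \<in> tournaments E" "e \<in> E" shows "w e = 0 \<or> w e = 1"
  using PiE_mem[OF assms[unfolded tournaments_def]] by simp

lemma score_flip_self:
  assumes "w \<in> tournaments E" "X \<subseteq> E"
  shows "score X (flip w X) k = - score X w k"
proof -
  have "(real (flip w X e) - 1/2) * edge_vec e k = - ((real (w e) - 1/2) * edge_vec e k)"
    if "e \<in> X" for e
    using tournaments_value[OF assms(1)] assms(2) that
    by (force simp: flip_def)
  then show ?thesis
    by (simp add: score_def sum_negf)
qed

lemma flip_flip:
  assumes "w \<in> tournaments E" "X \<subseteq> E"
  shows "flip (flip w X) X = w"
proof
  fix e show "flip (flip w X) X e = w e"
    using tournaments_value[OF assms(1), of e] assms(2) by (cases "e \<in> X") (force simp: flip_def)+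
qed

lemma flip_in_Tour:
  assumes "w \<in> Tour \<Phi> n s" "X \<subseteq> complete_sgraph \<Phi> n" "neutral w X"
  shows "flip w X \<in> Tour \<Phi> n s" and "neutral (flip w X) X"
proof -
  let ?E = "complete_sgraph \<Phi> n"
  have w: "w \<in> tournaments ?E" and s: "score ?E w = s"
    using assms(1) by (auto simp: Tour_def)
  have self: "score X (flip w X) k = score X w k" for k
    using score_flip_self[OF w assms(2), of k] assms(3) by (simp add: neutral_def)
  then show "neutral (flip w X) X"
    using assms(3) by (simp add: neutral_def fun_eq_iff)
  have split: "score ?E v k = score X v k + score (?E - X) v k" for v k
    unfolding score_def
    using sum.subset_diff[OF assms(2) finite_complete_sgraph] by (simp add: add.commute)
  have "score (?E - X) (flip w X) k = score (?E - X) w k" for k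
    unfolding score_def by (intro sum.cong) (auto simp: flip_def)
  with self have "score ?E (flip w X) = score ?E w"
    by (simp add: fun_eq_iff split)
  moreover have "flip w X \<in> tournaments ?E"
    unfolding tournaments_def
  proof (rule PiE_I)
    fix e assume "e \<in> ?E"
    with tournaments_value[OF w this] show "flip w X e \<in> {0, 1}"
      by (auto simp: flip_def)
  next
    fix e assume "e \<notin> ?E"
    moreover have "w e = undefined"
      using w \<open>e \<notin> ?E\<close> unfolding tournaments_def by (rule PiE_arb)
    ultimately show "flip w X e = undefined"
      using assms(2) unfolding flip_def by (metis subsetD)
  qed
  ultimately show "flip w X \<in> Tour \<Phi> n s"
    by (simp add: Tour_def s)
qed

lemma pseudo_graph_IntGr: "pseudo_graph (IntGr \<Phi> n s)"
proof
  let ?G = "IntGr \<Phi> n s"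
  let ?E = "complete_sgraph \<Phi> n"
  show "tail ?G e \<in> verts ?G" if "e \<in> arcs ?G" for e
    using that by (auto simp: IntGr_def)
  show "head ?G e \<in> verts ?G" if "e \<in> arcs ?G" for e
    using that by (auto simp: IntGr_def generator_copy_def intro: flip_in_Tour)
  have fin: "finite (Tour \<Phi> n s)"
    by (rule finite_subset[of _ "tournaments ?E"])
      (auto simp: Tour_def tournaments_def intro!: finite_PiE finite_complete_sgraph)
  then show "finite (verts ?G)" by (simp add: IntGr_def)
  have "arcs ?G \<subseteq> Tour \<Phi> n s \<times> Pow ?E \<times> {..<2}"
    by (auto simp: IntGr_def generator_copy_def split: if_splits)
  then show "finite (arcs ?G)"
    by (rule finite_subset) (auto intro: fin finite_complete_sgraph)
  show "symmetric ?G"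
    unfolding symmetric_conv
  proof
    fix a assume "a \<in> arcs ?G"
    then obtain w X m where a: "a = (w, X, m)" and w: "w \<in> Tour \<Phi> n s"
      and X: "generator_copy \<Phi> n w X" and m: "m < (if clover X then 2 else 1)"
      by (auto simp: IntGr_def)
    have *: "X \<subseteq> ?E" "neutral w X" using X by (auto simp: generator_copy_def)
    have "w \<in> tournaments ?E" using w by (simp add: Tour_def)
    then have "flip (flip w X) X = w" using *(1) by (rule flip_flip)
    moreover have "(flip w X, X, m) \<in> arcs ?G"
      using X m flip_in_Tour[OF w *] by (simp add: IntGr_def generator_copy_def)
    ultimately show "\<exists>b\<in>arcs ?G. tail ?G a = head ?G b \<and> head ?G a = tail ?G b"
      by (intro bexI[of _ "(flip w X, X, m)"]) (simp_all add: a IntGr_def)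
  qed
qed

end

theory Submission
  imports Defs
begin

text \<open>
  A tournament is lifted to a digraph on the integers \<open>-n, \<dots>, n\<close>: with \<open>e\<^sub>-\<^sub>i = - e\<^sub>i\<close> and \<open>e\<^sub>0 = 0\<close>, a game
  that contributes \<open>(e\<^sub>b - e\<^sub>a) / 2\<close> to the score becomes the arc \<open>a \<rightarrow> b\<close> together with its dual
  \<open>-b \<rightarrow> -a\<close>. The generators of all types are then exactly the directed triangles.

  For two tournaments with the same score, let \<open>D\<close> be the set of arcs of the first that are reversed
  in the second. If \<open>a \<rightarrow> b \<rightarrow> c\<close> in \<open>D\<close>, the vertices \<open>a\<close> and \<open>c\<close> are adjacent, and \<open>a \<rightarrow> c\<close> is not in
  \<open>D\<close>, then \<open>abc\<close> is a directed triangle in one of the two tournaments, and flipping it there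
  makes them agree on at least one more game. Otherwise \<open>D\<close> is transitive except at opposite pairs
  \<open>c = -a\<close>. Equality of scores gives every vertex with an incoming arc of \<open>D\<close> an outgoing one, and a
  vertex of least positive out-degree then leads to a contradiction unless \<open>D\<close> is empty. So the
  distance of two tournaments is at most the number of games on which they differ.
\<close>

section \<open>Lifting signed edges to pairs of signed vertices\<close>

text \<open>
  The game joining two vertices \<open>a \<noteq> b\<close> of the lifted digraph; for \<open>a = b\<close> the value is not a game of
  any complete signed graph.
\<close>

definition cover_edge :: "int \<Rightarrow> int \<Rightarrow> sedge" where
  "cover_edge a b =
     (if a = 0 then Half (nat \<bar>b\<bar>) else if b = 0 then Half (nat \<bar>a\<bar>)
      else if b = - a then Loop (nat \<bar>a\<bar>)
      else if (0 < a) = (0 < b) then neg_edge (nat \<bar>a\<bar>) (nat \<bar>b\<bar>)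
      else pos_edge (nat \<bar>a\<bar>) (nat \<bar>b\<bar>))"

definition cover_vec :: "int \<Rightarrow> nat \<Rightarrow> real" where
  "cover_vec a k = real_of_int (sgn a) * basis_vec (nat \<bar>a\<bar>) k"

text \<open>
  Whether the vector of \<open>cover_edge a b\<close> is \<open>cover_vec b - cover_vec a\<close> and not its negative: the larger
  endpoint of an edge has coefficient 1.
\<close>

definition cover_positive :: "int \<Rightarrow> int \<Rightarrow> bool" where
  "cover_positive a b \<longleftrightarrow> \<bar>a\<bar> \<le> \<bar>b\<bar> \<and> 0 < b \<or> \<bar>b\<bar> < \<bar>a\<bar> \<and> a < 0"

definition cover_arc :: "(sedge \<Rightarrow> nat) \<Rightarrow> int \<Rightarrow> int \<Rightarrow> bool" where
  "cover_arc w a b \<longleftrightarrow> w (cover_edge a b) = (if cover_positive a b then 1 else 0)"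

lemma nat_abs_eq_nat_abs_iff: "nat \<bar>a\<bar> = nat \<bar>b\<bar> \<longleftrightarrow> a = b \<or> a = - b"
  by linarith

lemma neg_edge_commute: "neg_edge i j = neg_edge j i"
  by (simp add: neg_edge_def max.commute min.commute)

lemma pos_edge_commute: "pos_edge i j = pos_edge j i"
  by (simp add: pos_edge_def max.commute min.commute)

lemma neg_edge_eq_iff: "neg_edge i j = neg_edge k l \<longleftrightarrow> i = k \<and> j = l \<or> i = l \<and> j = k"
  unfolding neg_edge_def sedge.inject max_def min_def by presburger

lemma pos_edge_eq_iff: "pos_edge i j = pos_edge k l \<longleftrightarrow> i = k \<and> j = l \<or> i = l \<and> j = k"
  unfolding pos_edge_def sedge.inject max_def min_def by presburger

lemma pair_edge_distinct [simp]:
  "neg_edge i j \<noteq> pos_edge k l" "pos_edge k l \<noteq> neg_edge i j"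
  "neg_edge i j \<noteq> Half k" "Half k \<noteq> neg_edge i j" "neg_edge i j \<noteq> Loop k" "Loop k \<noteq> neg_edge i j"
  "pos_edge i j \<noteq> Half k" "Half k \<noteq> pos_edge i j" "pos_edge i j \<noteq> Loop k" "Loop k \<noteq> pos_edge i j"
  by (simp_all add: neg_edge_def pos_edge_def)

lemma edge_vec_neg_edge:
  "edge_vec (neg_edge i j) k = (if j \<le> i then 1 else -1) * (basis_vec i k - basis_vec j k)"
  by (simp add: neg_edge_def max_def min_def)

lemma edge_vec_pos_edge: "edge_vec (pos_edge i j) k = basis_vec i k + basis_vec j k"
  by (simp add: pos_edge_def max_def min_def)

lemma pair_edge_in_iff [simp]:
  "neg_edge i j \<in> complete_sgraph \<Phi> n \<longleftrightarrow> i \<noteq> j \<and> i \<in> {1..n} \<and> j \<in> {1..n}"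
  "pos_edge i j \<in> complete_sgraph \<Phi> n \<longleftrightarrow> i \<noteq> j \<and> i \<in> {1..n} \<and> j \<in> {1..n}"
  "Half i \<in> complete_sgraph \<Phi> n \<longleftrightarrow> \<Phi> = Type_B \<and> i \<in> {1..n}"
  "Loop i \<in> complete_sgraph \<Phi> n \<longleftrightarrow> \<Phi> = Type_C \<and> i \<in> {1..n}"
  by (cases \<Phi>; auto simp: neg_edge_def pos_edge_def pair_edges_def max_def min_def)+

lemma cover_edge_commute: "cover_edge a b = cover_edge b a"
  by (simp add: cover_edge_def neg_edge_commute[of "nat \<bar>b\<bar>"] pos_edge_commute[of "nat \<bar>b\<bar>"])

lemma cover_edge_uminus: "cover_edge (- b) (- a) = cover_edge a b"
proof -
  have "cover_edge (- a) (- b) = cover_edge a b"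
    by (auto simp: cover_edge_def)
  then show ?thesis
    by (simp add: cover_edge_commute)
qed

text \<open>A game determines its pair of lifted vertices up to negation, and
  \<open>{b, c} = {- a, - b}\<close> with \<open>c \<noteq> a\<close> forces
  \<open>b = 0\<close>.\<close>

lemma cover_edge_eq_iff:
  assumes "a \<noteq> b" "b \<noteq> c" "a \<noteq> c"
  shows "cover_edge a b = cover_edge b c \<longleftrightarrow> b = 0 \<and> c = - a"
  using assms
  by (auto simp: cover_edge_def neg_edge_eq_iff pos_edge_eq_iff nat_abs_eq_nat_abs_iff split: if_split_asm)

lemma cover_edge_in_iff:
  assumes "a \<noteq> b"
  shows "cover_edge a b \<in> complete_sgraph \<Phi> n \<longleftrightarrow> \<bar>a\<bar> \<le> int n \<and> \<bar>b\<bar> \<le> int n \<and>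
    (a = 0 \<or> b = 0 \<longrightarrow> \<Phi> = Type_B) \<and> (b = - a \<longrightarrow> \<Phi> = Type_C)"
  using assms
  by (auto simp: cover_edge_def nat_abs_eq_nat_abs_iff)

lemma cover_edge_self: "cover_edge a a \<notin> complete_sgraph \<Phi> n"
  by (simp add: cover_edge_def)

text \<open>The delicate case is \<open>\<bar>a\<bar> = \<bar>b\<bar>\<close>: there
  \<open>b = - a\<close>, so \<open>0 < b\<close> and \<open>a < 0\<close> agree and the asymmetric
  tie-breaking does no harm.\<close>

lemma cover_positive_uminus: "a \<noteq> b \<Longrightarrow> cover_positive (- b) (- a) \<longleftrightarrow> cover_positive a b"
  unfolding cover_positive_def by (smt (verit))

lemma cover_positive_commute: "a \<noteq> b \<Longrightarrow> cover_positive b a \<longleftrightarrow> \<not> cover_positive a b"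
  unfolding cover_positive_def by (smt (verit))

lemma cover_arc_uminus: "a \<noteq> b \<Longrightarrow> cover_arc w (- b) (- a) \<longleftrightarrow> cover_arc w a b"
  by (simp add: cover_arc_def cover_edge_uminus cover_positive_uminus)

lemma cover_arc_commute:
  assumes "w \<in> tournaments E" "cover_edge a b \<in> E" "a \<noteq> b"
  shows "cover_arc w b a \<longleftrightarrow> \<not> cover_arc w a b"
  using tournaments_value[OF assms(1,2)] assms(3)
  by (auto simp: cover_arc_def cover_edge_commute[of b a] cover_positive_commute[OF assms(3)])

text \<open>One lift serves all types because, up to sign, every edge vector is a difference: a half
  edge is \<open>e\<^sub>i - 0\<close>, a loop is \<open>e\<^sub>i - (- e\<^sub>i)\<close>, a
  positive edge is \<open>e\<^sub>i - (- e\<^sub>j)\<close>.\<close>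

lemma edge_vec_cover_edge:
  assumes "a \<noteq> b"
  shows "edge_vec (cover_edge a b) k =
    (if cover_positive a b then 1 else -1) * (cover_vec b k - cover_vec a k)"
proof -
  consider "a = 0" "b \<noteq> 0" | "a \<noteq> 0" "b = 0" | "a \<noteq> 0" "b = - a"
    | "a > 0" "b > 0" | "a > 0" "b < 0" "b \<noteq> - a" | "a < 0" "b > 0" "b \<noteq> - a" | "a < 0" "b < 0"
    using assms by linarith
  then show ?thesis
    using assms
    by cases (auto simp: cover_edge_def cover_positive_def cover_vec_def edge_vec_neg_edge edge_vec_pos_edge sgn_if)
qed

lemma cover_arc_vec:
  assumes "cover_arc w a b" "a \<noteq> b"
  shows "(real (w (cover_edge a b)) - 1/2) * edge_vec (cover_edge a b) k =
    (cover_vec b k - cover_vec a k) / 2"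
  using assms(1) by (simp add: cover_arc_def edge_vec_cover_edge[OF assms(2)] del: edge_vec.simps)

text \<open>Seen from the signed vertex \<open>b\<close>, a negative edge leads to a vertex of the
  same sign and a positive edge to one of the opposite sign.\<close>

lemma cover_edge_sgn:
  assumes "b \<noteq> 0" "0 < j" "j \<noteq> nat \<bar>b\<bar>"
  shows "cover_edge b (sgn b * int j) = neg_edge (nat \<bar>b\<bar>) j"
    and "cover_edge b (- sgn b * int j) = pos_edge (nat \<bar>b\<bar>) j"
    and "\<bar>sgn b * int j\<bar> \<noteq> \<bar>b\<bar>"
  using assms by (auto simp: cover_edge_def sgn_if)

text \<open>The lift of a game is closed under negation, so a game that meets \<open>- b\<close>
  also meets \<open>b\<close>. This lets the score at coordinate \<open>\<bar>b\<bar>\<close> be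
  read as a sum over arcs at \<open>b\<close> itself.\<close>

lemma incident_edge_is_cover_edge:
  assumes e: "e \<in> complete_sgraph \<Phi> n" and b: "b \<noteq> 0" and vec: "edge_vec e (nat \<bar>b\<bar>) \<noteq> 0"
  obtains c where "c \<noteq> b" "e = cover_edge b c"
proof -
  consider (pair) i j where "i \<noteq> j" "0 < i" "0 < j" "e = neg_edge i j \<or> e = pos_edge i j"
    | (half) i where "e = Half i" | (loop) i where "e = Loop i"
  proof (cases e)
    case (Neg i j)
    then show ?thesis using e pair(1)[of i j] by (cases \<Phi>) (auto simp: pair_edges_def neg_edge_def)
  next
    case (Pos i j)
    then show ?thesis using e pair(1)[of i j] by (cases \<Phi>) (auto simp: pair_edges_def pos_edge_def)
  qed blast+
  then show ?thesis
  proof cases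
    case pair
    then have "nat \<bar>b\<bar> = i \<or> nat \<bar>b\<bar> = j"
      using vec by (auto simp: edge_vec_neg_edge edge_vec_pos_edge basis_vec_def split: if_split_asm)
    then obtain k where k: "0 < k" "k \<noteq> nat \<bar>b\<bar>"
      "e = neg_edge (nat \<bar>b\<bar>) k \<or> e = pos_edge (nat \<bar>b\<bar>) k"
      using pair neg_edge_commute pos_edge_commute by metis
    note sgn = cover_edge_sgn[OF b k(1,2)]
    show ?thesis
      using k(3) sgn that[of "sgn b * int k"] that[of "- sgn b * int k"] by auto
  next
    case half
    then have "e = cover_edge b 0"
      using vec b by (simp add: cover_edge_def basis_vec_def split: if_split_asm)
    then show ?thesis using b that[of 0] by simp
  next
    case loop
    then have "e = cover_edge b (- b)"
      using vec b by (simp add: cover_edge_def basis_vec_def split: if_split_asm)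
    then show ?thesis using b that[of "- b"] by simp
  qed
qed

lemma edge_is_cover_edge:
  assumes "e \<in> complete_sgraph \<Phi> n"
  obtains a b where "a \<noteq> b" "e = cover_edge a b"
proof -
  have "\<exists>k>0. edge_vec e k \<noteq> 0"
    using assms by (cases \<Phi>; fastforce simp: pair_edges_def basis_vec_def)
  then obtain k where "0 < k" "edge_vec e (nat \<bar>int k\<bar>) \<noteq> 0" by auto
  then show ?thesis
    by (metis that incident_edge_is_cover_edge[OF assms, of "int k"] of_nat_0_less_iff less_irrefl)
qed

section \<open>Generators as directed triangles of the lift\<close>

text \<open>The opposite pair gives the loop; the sides from \<open>a\<close> and from
  \<open>- a\<close> to \<open>c\<close> are the negative and the positive edge between the same two
  vertices.\<close>

lemma clover_cover_edges:
  assumes "a \<noteq> 0" "c \<noteq> 0" "c \<noteq> a" "c \<noteq> - a"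
  shows "clover {cover_edge a (- a), cover_edge (- a) c, cover_edge c a}"
  unfolding clover_def
  by (rule exI[of _ "nat \<bar>a\<bar>"], rule exI[of _ "nat \<bar>c\<bar>"])
    (use assms in \<open>auto simp: cover_edge_def nat_abs_eq_nat_abs_iff neg_edge_commute[of "nat \<bar>c\<bar>"] pos_edge_commute[of "nat \<bar>c\<bar>"]\<close>)

lemma half_edge_triangle_cover_edges:
  assumes "b \<noteq> 0" "c \<noteq> 0" "c \<noteq> b" "c \<noteq> - b"
  shows "half_edge_triangle {cover_edge 0 b, cover_edge b c, cover_edge c 0}"
  unfolding half_edge_triangle_def
  by (rule exI[of _ "nat \<bar>b\<bar>"], rule exI[of _ "nat \<bar>c\<bar>"])
    (use assms in \<open>auto simp: cover_edge_def nat_abs_eq_nat_abs_iff\<close>)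

lemma cover_edge_pair:
  assumes "a \<noteq> 0" "b \<noteq> 0" "\<bar>a\<bar> \<noteq> \<bar>b\<bar>"
  shows "cover_edge a b = (if (0 < a) = (0 < b) then neg_edge (nat \<bar>a\<bar>) (nat \<bar>b\<bar>)
    else pos_edge (nat \<bar>a\<bar>) (nat \<bar>b\<bar>))"
  using assms by (auto simp: cover_edge_def)

text \<open>Two of the three signs agree, and after a rotation these belong to the first two
  vertices, which span a negative edge. The third sign either agrees as well, giving three negative
  edges, or differs, giving two positive ones.\<close>

lemma triangle_cover_edges:
  assumes nz: "a \<noteq> 0" "b \<noteq> 0" "c \<noteq> 0" and abs: "\<bar>a\<bar> \<noteq> \<bar>b\<bar>" "\<bar>b\<bar> \<noteq> \<bar>c\<bar>" "\<bar>c\<bar> \<noteq> \<bar>a\<bar>"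
  shows "triangle {cover_edge a b, cover_edge b c, cover_edge c a}"
proof -
  have two: "triangle {cover_edge x y, cover_edge y z, cover_edge z x}"
    if nz: "x \<noteq> 0" "y \<noteq> 0" "z \<noteq> 0" and abs: "\<bar>x\<bar> \<noteq> \<bar>y\<bar>" "\<bar>y\<bar> \<noteq> \<bar>z\<bar>" "\<bar>z\<bar> \<noteq> \<bar>x\<bar>"
      and sign: "(0 < x) = (0 < y)" for x y z
  proof -
    have ne: "nat \<bar>x\<bar> \<noteq> nat \<bar>y\<bar>" "nat \<bar>y\<bar> \<noteq> nat \<bar>z\<bar>" "nat \<bar>x\<bar> \<noteq> nat \<bar>z\<bar>"
      using abs by auto
    show ?thesis
      unfolding triangle_def cover_edge_pair[OF nz(1,2) abs(1)] cover_edge_pair[OF nz(2,3) abs(2)]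
        cover_edge_pair[OF nz(3,1) abs(3)] neg_edge_commute[of "nat \<bar>z\<bar>"] pos_edge_commute[of "nat \<bar>z\<bar>"]
      by (intro exI[of _ "nat \<bar>x\<bar>"] exI[of _ "nat \<bar>y\<bar>"] exI[of _ "nat \<bar>z\<bar>"], cases "(0 < y) = (0 < z)")
        (simp_all add: ne sign eq_commute[of "0 < z"])
  qed
  have rotate: "{p, q, r} = {q, r, p}" for p q r :: sedge by blast
  consider "(0 < a) = (0 < b)" | "(0 < b) = (0 < c)" | "(0 < c) = (0 < a)" by blast
  then show ?thesis
    using two[OF nz abs] two[OF nz(2,3,1) abs(2,3,1)] two[OF nz(3,1,2) abs(3,1,2)]
    by cases (simp_all only: rotate[of "cover_edge a b"] rotate[of "cover_edge c a"] simp_thms)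
qed

text \<open>The contributions to the score telescope around the triangle. Its kind depends on
  whether it contains \<open>0\<close>, an opposite pair, or neither. The second conclusion
  guarantees that a flip changes two different games.\<close>

lemma generator_copy_cover_triangle:
  assumes E: "cover_edge a b \<in> complete_sgraph \<Phi> n" "cover_edge b c \<in> complete_sgraph \<Phi> n"
      "cover_edge c a \<in> complete_sgraph \<Phi> n"
    and arcs: "cover_arc w a b" "cover_arc w b c" "cover_arc w c a"
  shows "generator_copy \<Phi> n w {cover_edge a b, cover_edge b c, cover_edge c a}"
    and "cover_edge a b \<noteq> cover_edge b c"
proof -
  let ?X = "{cover_edge a b, cover_edge b c, cover_edge c a}"
  have ne: "a \<noteq> b" "b \<noteq> c" "c \<noteq> a"
    using E cover_edge_self by blast+
  note in_iff = E(1)[unfolded cover_edge_in_iff[OF ne(1)]] E(2)[unfolded cover_edge_in_iff[OF ne(2)]]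
    E(3)[unfolded cover_edge_in_iff[OF ne(3)]]
  \<comment> \<open>Two equal sides would need a half edge at \<open>0\<close> and a loop in the
    same graph, which no type has.\<close>
  have distinct: "cover_edge a b \<noteq> cover_edge b c" "cover_edge b c \<noteq> cover_edge c a"
    "cover_edge c a \<noteq> cover_edge a b"
    using ne in_iff cover_edge_eq_iff[of a b c] cover_edge_eq_iff[of b c a] cover_edge_eq_iff[of c a b]
    by auto
  then show "cover_edge a b \<noteq> cover_edge b c" by blast
  have "neutral w ?X"
    using distinct ne arcs by (simp add: neutral_def score_def cover_arc_vec fun_eq_iff add_divide_distrib[symmetric])
  moreover have "triangle ?X \<or> \<Phi> = Type_B \<and> half_edge_triangle ?X \<or> \<Phi> = Type_C \<and> clover ?X"
  proof -
    consider "a = 0" | "b = 0" | "c = 0" | "a \<noteq> 0" "b \<noteq> 0" "c \<noteq> 0" "b = - a"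
      | "a \<noteq> 0" "b \<noteq> 0" "c \<noteq> 0" "c = - b" | "a \<noteq> 0" "b \<noteq> 0" "c \<noteq> 0" "a = - c"
      | "a \<noteq> 0" "b \<noteq> 0" "c \<noteq> 0" "\<bar>a\<bar> \<noteq> \<bar>b\<bar>" "\<bar>b\<bar> \<noteq> \<bar>c\<bar>" "\<bar>c\<bar> \<noteq> \<bar>a\<bar>"
      using ne by linarith
    then show ?thesis
    proof cases
      case 1
      then have "half_edge_triangle ?X" "\<Phi> = Type_B"
        using half_edge_triangle_cover_edges[of b c] ne in_iff by auto
      then show ?thesis by blast
    next
      case 2
      then have "half_edge_triangle ?X" "\<Phi> = Type_B"
        using half_edge_triangle_cover_edges[of c a] ne in_iff by (auto simp: insert_commute)
      then show ?thesis by blast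
    next
      case 3
      then have "half_edge_triangle ?X" "\<Phi> = Type_B"
        using half_edge_triangle_cover_edges[of a b] ne in_iff by (auto simp: insert_commute)
      then show ?thesis by blast
    next
      case 4
      then have "clover ?X" "\<Phi> = Type_C"
        using clover_cover_edges[of a c] ne in_iff by auto
      then show ?thesis by blast
    next
      case 5
      then have "clover ?X" "\<Phi> = Type_C"
        using clover_cover_edges[of b a] ne in_iff by (auto simp: insert_commute)
      then show ?thesis by blast
    next
      case 6
      then have "clover ?X" "\<Phi> = Type_C"
        using clover_cover_edges[of c b] ne in_iff by (auto simp: insert_commute)
      then show ?thesis by blast
    next
      case 7
      then show ?thesis using triangle_cover_edges by blast
    qed
  qed
  ultimately show "generator_copy \<Phi> n w ?X"
    using E by (simp add: generator_copy_def)
qed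

section \<open>The digraph of differences of two tournaments\<close>

definition diff_arc :: "sedge set \<Rightarrow> (sedge \<Rightarrow> nat) \<Rightarrow> (sedge \<Rightarrow> nat) \<Rightarrow> int \<Rightarrow> int \<Rightarrow> bool" where
  "diff_arc E w v a b \<longleftrightarrow> cover_edge a b \<in> E \<and> cover_arc w a b \<and> \<not> cover_arc v a b"

definition diff_edges :: "sedge set \<Rightarrow> (sedge \<Rightarrow> nat) \<Rightarrow> (sedge \<Rightarrow> nat) \<Rightarrow> sedge set" where
  "diff_edges E w v = {e \<in> E. w e \<noteq> v e}"

lemma diff_edges_commute: "diff_edges E w v = diff_edges E v w"
  by (auto simp: diff_edges_def)

lemma diff_arc_iff:
  assumes "w \<in> tournaments E" "v \<in> tournaments E"
  shows "diff_arc E w v a b \<longleftrightarrow> cover_edge a b \<in> diff_edges E w v \<and> cover_arc w a b"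
  using tournaments_value[OF assms(1), of "cover_edge a b"] tournaments_value[OF assms(2), of "cover_edge a b"]
  by (auto simp: diff_arc_def diff_edges_def cover_arc_def)

text \<open>The flip removes \<open>x\<close> and \<open>y\<close> from the set of differing games
  and adds at most \<open>z\<close>.\<close>

lemma card_diff_edges_flip_less:
  assumes w: "w \<in> tournaments E" and v: "v \<in> tournaments E" and fin: "finite E"
    and xy: "x \<in> diff_edges E w v" "y \<in> diff_edges E w v" "x \<noteq> y"
  shows "card (diff_edges E (flip w {x, y, z}) v) < card (diff_edges E w v)"
proof -
  let ?D = "diff_edges E w v"
  have fin': "finite ?D" using fin by (simp add: diff_edges_def)
  have val: "flip w {x, y, z} e = v e" if "e \<in> {x, y}" for e
    using that xy tournaments_value[OF w, of e] tournaments_value[OF v, of e]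
    by (auto simp: flip_def diff_edges_def)
  have "diff_edges E (flip w {x, y, z}) v \<subseteq> insert z (?D - {x, y})"
  proof
    fix e assume e: "e \<in> diff_edges E (flip w {x, y, z}) v"
    then have "e \<notin> {x, y}" using val by (auto simp: diff_edges_def)
    with e show "e \<in> insert z (?D - {x, y})"
      by (cases "e = z") (simp_all add: diff_edges_def flip_def)
  qed
  then have "card (diff_edges E (flip w {x, y, z}) v) \<le> card (insert z (?D - {x, y}))"
    using fin' by (intro card_mono) auto
  also have "\<dots> \<le> Suc (card (?D - {x, y}))"
    by (simp add: card_insert_if fin')
  also have "\<dots> < card ?D"
  proof -
    have "card {x, y} \<le> card ?D" using xy fin' by (intro card_mono) auto
    then show ?thesis using xy fin' by (simp add: card_Diff_subset)
  qed
  finally show ?thesis .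
qed

lemma diff_arc_uminus:
  assumes "diff_arc (complete_sgraph \<Phi> n) w v a b"
  shows "diff_arc (complete_sgraph \<Phi> n) w v (- b) (- a)"
proof -
  have "a \<noteq> b" using assms cover_edge_self by (auto simp: diff_arc_def)
  then show ?thesis
    using assms by (simp add: diff_arc_def cover_edge_uminus cover_arc_uminus)
qed

lemma diff_arc_asym:
  assumes "w \<in> tournaments (complete_sgraph \<Phi> n)" "diff_arc (complete_sgraph \<Phi> n) w v a b"
  shows "\<not> diff_arc (complete_sgraph \<Phi> n) w v b a"
  using assms cover_arc_commute[OF assms(1), of a b] cover_edge_self
  by (auto simp: diff_arc_def)

text \<open>The tail cannot cancel the head: its coordinate at \<open>\<bar>b\<bar>\<close> is 0
  unless \<open>a = - b\<close>, and then it reinforces the head. The factor \<open>sgn b\<close>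
  makes incoming arcs count positively for either sign of \<open>b\<close>.\<close>

lemma diff_arc_pos:
  assumes w: "w \<in> tournaments (complete_sgraph \<Phi> n)" and v: "v \<in> tournaments (complete_sgraph \<Phi> n)"
    and ab: "diff_arc (complete_sgraph \<Phi> n) w v a b" and b: "b \<noteq> 0"
  defines "e \<equiv> cover_edge a b"
  shows "0 < (real (w e) - real (v e)) * edge_vec e (nat \<bar>b\<bar>) * real_of_int (sgn b)"
proof -
  have ne: "a \<noteq> b" using ab cover_edge_self by (auto simp: diff_arc_def)
  have wab: "cover_arc w a b" and vba: "cover_arc v b a"
    using ab cover_arc_commute[OF v _ ne] by (auto simp: diff_arc_def)
  let ?k = "nat \<bar>b\<bar>"
  have "(real (w e) - real (v e)) * edge_vec e ?k = cover_vec b ?k - cover_vec a ?k"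
    using cover_arc_vec[OF wab ne, of ?k] cover_arc_vec[OF vba ne[symmetric], of ?k]
    by (simp add: e_def cover_edge_commute[of b a] field_simps)
  moreover have "cover_vec b ?k = real_of_int (sgn b)"
    by (simp add: cover_vec_def basis_vec_def)
  moreover have "cover_vec a ?k * real_of_int (sgn b) \<le> 0"
    using ne by (auto simp: cover_vec_def basis_vec_def nat_abs_eq_nat_abs_iff sgn_if)
  moreover have "real_of_int (sgn b) * real_of_int (sgn b) = 1"
    using b by (simp add: sgn_if)
  ultimately show ?thesis by (simp add: left_diff_distrib)
qed

text \<open>Equal scores make the signed differences at \<open>b\<close> sum to 0. The incoming arc
  contributes a positive term, so some term is negative, and its game cannot enter
  \<open>b\<close>.\<close>

lemma diff_arc_successor:
  assumes w: "w \<in> Tour \<Phi> n s" and v: "v \<in> Tour \<Phi> n s"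
    and ab: "diff_arc (complete_sgraph \<Phi> n) w v a b"
  shows "\<exists>c. diff_arc (complete_sgraph \<Phi> n) w v b c"
proof (cases "b = 0")
  case True
  \<comment> \<open>The vertex \<open>0\<close> has no coordinate in the score; the dual arc
    \<open>0 \<rightarrow> - a\<close> serves instead.\<close>
  then show ?thesis using diff_arc_uminus[OF ab] by auto
next
  case False
  let ?E = "complete_sgraph \<Phi> n"
  define f where "f e = (real (w e) - real (v e)) * edge_vec e (nat \<bar>b\<bar>) * real_of_int (sgn b)" for e
  have wT: "w \<in> tournaments ?E" and vT: "v \<in> tournaments ?E"
    using w v by (auto simp: Tour_def)
  have "(\<Sum>e\<in>?E. f e) = (score ?E w (nat \<bar>b\<bar>) - score ?E v (nat \<bar>b\<bar>)) * real_of_int (sgn b)"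
    unfolding f_def score_def sum_subtractf[symmetric] sum_distrib_right
    by (intro sum.cong refl) (simp add: algebra_simps)
  then have sum0: "(\<Sum>e\<in>?E. f e) = 0"
    using w v by (simp add: Tour_def)
  have "\<exists>e\<in>?E. f e < 0"
  proof (rule ccontr)
    assume "\<not> ?thesis"
    then have "0 < (\<Sum>e\<in>?E. f e)"
      using diff_arc_pos[OF wT vT ab False] ab
      by (intro sum_pos2[OF finite_complete_sgraph, of "cover_edge a b"])
        (auto simp: f_def diff_arc_def not_less)
    with sum0 show False by simp
  qed
  then obtain e where e: "e \<in> ?E" "f e < 0" by blast
  then have "edge_vec e (nat \<bar>b\<bar>) \<noteq> 0" and wv: "w e \<noteq> v e"
    by (auto simp: f_def)
  then obtain c where c: "c \<noteq> b" "e = cover_edge b c"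
    using incident_edge_is_cover_edge[OF e(1) False] by blast
  have "\<not> diff_arc ?E w v c b"
    using diff_arc_pos[OF wT vT _ False, of c] e(2) by (auto simp: f_def c(2) cover_edge_commute[of b c])
  then have "diff_arc ?E w v b c"
    using e(1) wv c cover_arc_commute[OF wT, of b c]
    by (auto simp: diff_arc_iff[OF wT vT] diff_edges_def cover_edge_commute[of c b])
  then show ?thesis ..
qed

section \<open>Skew-symmetric digraphs that are almost transitive\<close>

text \<open>Least positive out-degree at \<open>a\<close> determines the out-neighbours of its
  successors, and duality then leaves \<open>0\<close> as the only successor of \<open>a\<close>;
  following the arcs past \<open>0\<close> yields another. The last conjunct of \<open>trans\<close>
  covers all types at once: the exception \<open>c = - a\<close> is granted only where no arc joins
  opposite vertices.\<close>

lemma skew_quasi_transitive_empty: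
  fixes D :: "int \<Rightarrow> int \<Rightarrow> bool"
  assumes fin: "\<And>a. finite {b. D a b}"
    and asym: "\<And>a b. D a b \<Longrightarrow> \<not> D b a"
    and dual: "\<And>a b. D a b \<Longrightarrow> D (- b) (- a)"
    and succ: "\<And>a b. D a b \<Longrightarrow> \<exists>c. D b c"
    and trans: "\<And>a b c. D a b \<Longrightarrow> D b c \<Longrightarrow> D a c \<or> c = - a \<and> (\<forall>x. \<not> D x (- x))"
  shows "\<not> D p q"
proof
  assume "D p q"
  then obtain a where a: "\<exists>b. D a b"
    and min: "\<And>x. \<exists>y. D x y \<Longrightarrow> card {b. D a b} \<le> card {b. D x b}"
    using ex_has_least_nat[of "\<lambda>x. \<exists>y. D x y" p "\<lambda>x. card {b. D x b}"] by blast
  \<comment> \<open>Almost-transitivity and asymmetry give the inclusion. Since \<open>b\<close> is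
    lost, minimality forces the one possible new vertex \<open>- a\<close> to occur, so the
    exception in \<open>trans\<close> has been used and its side condition holds.\<close>
  have out: "{x. D b x} = insert (- a) ({x. D a x} - {b})" and no_opp: "\<forall>x. \<not> D x (- x)"
    if b: "D a b" for b
  proof -
    let ?A = "{x. D a x}" and ?B = "{x. D b x}"
    have le: "card ?A \<le> card ?B" using min succ[OF b] by blast
    have not_sub: "\<not> ?B \<subseteq> ?A - {b}"
    proof
      assume "?B \<subseteq> ?A - {b}"
      then have "card ?B \<le> card (?A - {b})" using fin by (intro card_mono) auto
      also have "\<dots> < card ?A" using fin b by (intro card_Diff1_less) auto
      finally show False using le by simp
    qed
    then obtain x where x: "D b x" "\<not> D a x" using asym by blast
    then show "\<forall>x. \<not> D x (- x)" using trans[OF b] by blast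
    have sub: "?B \<subseteq> insert (- a) (?A - {b})" using trans[OF b] asym by blast
    have "card (insert (- a) (?A - {b})) \<le> Suc (card (?A - {b}))"
      using fin by (simp add: card_insert_if)
    also have "\<dots> = card ?A" using fin b by (intro card_Suc_Diff1) auto
    finally show "?B = insert (- a) (?A - {b})"
      using le fin by (intro card_seteq[OF _ sub]) auto
  qed
  have out_iff: "D b x \<longleftrightarrow> x = - a \<or> D a x \<and> x \<noteq> b" if "D a b" for b x
    using out[OF that] unfolding set_eq_iff by simp
  \<comment> \<open>From \<open>b \<rightarrow> - a\<close> duality gives
    \<open>a \<rightarrow> - b\<close>; for \<open>b \<noteq> - b\<close> this would be passed on to
    \<open>b \<rightarrow> - b\<close>.\<close>
  have zero: "b = 0" if b: "D a b" for b
  proof (rule ccontr)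
    assume "b \<noteq> 0"
    then have "- b \<noteq> b" by simp
    moreover have "D a (- b)" using out_iff[OF b, of "- a"] dual[of b "- a"] by simp
    ultimately have "D b (- b)" using out_iff[OF b] by blast
    then show False using no_opp[OF b] by blast
  qed
  have a0: "D a 0" using a zero by blast
  then have 0: "D 0 (- a)" using out_iff by blast
  \<comment> \<open>The path \<open>- d \<rightarrow> a \<rightarrow> 0 \<rightarrow> - a\<close> is
    shortcut twice to \<open>- d \<rightarrow> - a\<close>, whose dual
    \<open>a \<rightarrow> d\<close> gives \<open>a\<close> a nonzero successor.\<close>
  then obtain d where "D (- a) d" using succ by blast
  then have d: "D (- d) a" using dual[of "- a" d] by simp
  have "d \<noteq> 0"
  proof
    assume "d = 0"
    then show False using d asym[OF a0] by simp
  qed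
  then have d0: "D (- d) 0" using trans[OF d a0] by simp
  have "- a \<noteq> d"
  proof
    assume "- a = d"
    then have "D a a" using d by auto
    then show False using asym by blast
  qed
  then have "D (- d) (- a)" using trans[OF d0 0] by simp
  then have "D a d" using dual[of "- d" "- a"] by simp
  then show False using zero \<open>d \<noteq> 0\<close> by blast
qed

section \<open>Existence of a flip that brings two tournaments closer\<close>

lemma diff_arc_trans_or_reduce:
  assumes w: "w \<in> tournaments (complete_sgraph \<Phi> n)" and v: "v \<in> tournaments (complete_sgraph \<Phi> n)"
    and ab: "diff_arc (complete_sgraph \<Phi> n) w v a b" and bc: "diff_arc (complete_sgraph \<Phi> n) w v b c"
    and ca: "cover_edge c a \<in> complete_sgraph \<Phi> n" and ac: "\<not> diff_arc (complete_sgraph \<Phi> n) w v a c"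
  shows "\<exists>X. generator_copy \<Phi> n w X \<and>
        card (diff_edges (complete_sgraph \<Phi> n) (flip w X) v) < card (diff_edges (complete_sgraph \<Phi> n) w v)
      \<or> generator_copy \<Phi> n v X \<and>
        card (diff_edges (complete_sgraph \<Phi> n) w (flip v X)) < card (diff_edges (complete_sgraph \<Phi> n) w v)"
proof -
  let ?E = "complete_sgraph \<Phi> n"
  have ne: "a \<noteq> b" "b \<noteq> c" "c \<noteq> a"
    using ab bc ca cover_edge_self by (auto simp: diff_arc_def)
  have E: "cover_edge a b \<in> ?E" "cover_edge b c \<in> ?E"
    using ab bc by (auto simp: diff_arc_def)
  have diff: "cover_edge a b \<in> diff_edges ?E w v" "cover_edge b c \<in> diff_edges ?E w v"
    and arcs: "cover_arc w a b" "cover_arc w b c"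
    using ab bc by (auto simp: diff_arc_iff[OF w v])
  show ?thesis
  proof (cases "cover_arc w c a")
    case True
    note gen = generator_copy_cover_triangle[OF E ca arcs True]
    show ?thesis
      using gen(1) card_diff_edges_flip_less[OF w v finite_complete_sgraph diff gen(2)] by blast
  next
    case False
    \<comment> \<open>Here \<open>w\<close> has the arc \<open>a \<rightarrow> c\<close> and
      \<open>v\<close> does not reverse it, so it closes the path
      \<open>c \<rightarrow> b \<rightarrow> a\<close> of \<open>v\<close> to a directed
      triangle.\<close>
    then have "cover_arc v a c"
      using ac ca cover_arc_commute[OF w ca ne(3)]
      by (auto simp: diff_arc_def cover_edge_commute[of a c])
    moreover have "cover_arc v b a" "cover_arc v c b"
      using ab bc cover_arc_commute[OF v E(1) ne(1)] cover_arc_commute[OF v E(2) ne(2)]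
      by (auto simp: diff_arc_def)
    moreover have rev: "cover_edge c b \<in> ?E" "cover_edge b a \<in> ?E" "cover_edge a c \<in> ?E"
      using E ca by (simp_all add: cover_edge_commute)
    ultimately have gen: "generator_copy \<Phi> n v {cover_edge c b, cover_edge b a, cover_edge a c}"
      "cover_edge c b \<noteq> cover_edge b a"
      using generator_copy_cover_triangle[OF rev] by blast+
    have "cover_edge c b \<in> diff_edges ?E v w" "cover_edge b a \<in> diff_edges ?E v w"
      using diff by (simp_all add: cover_edge_commute[of c b] cover_edge_commute[of b a] diff_edges_commute[of _ v])
    from card_diff_edges_flip_less[OF v w finite_complete_sgraph this gen(2)]
    show ?thesis using gen(1) diff_edges_commute by metis
  qed
qed

lemma reducing_generator_exists:
  assumes w: "w \<in> Tour \<Phi> n s" and v: "v \<in> Tour \<Phi> n s" and "w \<noteq> v"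
  shows "\<exists>X. generator_copy \<Phi> n w X \<and>
        card (diff_edges (complete_sgraph \<Phi> n) (flip w X) v) < card (diff_edges (complete_sgraph \<Phi> n) w v)
      \<or> generator_copy \<Phi> n v X \<and>
        card (diff_edges (complete_sgraph \<Phi> n) w (flip v X)) < card (diff_edges (complete_sgraph \<Phi> n) w v)"
proof (rule ccontr)
  assume irred: "\<not> ?thesis"
  let ?E = "complete_sgraph \<Phi> n"
  let ?D = "diff_arc ?E w v"
  have wT: "w \<in> tournaments ?E" and vT: "v \<in> tournaments ?E"
    using w v by (auto simp: Tour_def)
  note asym = diff_arc_asym[OF wT]
  have fin: "finite {b. ?D a b}" for a
  proof (rule finite_subset)
    show "{b. ?D a b} \<subseteq> {- int n..int n}"
    proof
      fix b assume "b \<in> {b. ?D a b}"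
      then have "cover_edge a b \<in> ?E" by (simp add: diff_arc_def)
      moreover from this have "a \<noteq> b" using cover_edge_self by blast
      ultimately show "b \<in> {- int n..int n}" using cover_edge_in_iff by fastforce
    qed
  qed simp
  have trans: "?D a c \<or> c = - a \<and> (\<forall>x. \<not> ?D x (- x))" if "?D a b" "?D b c" for a b c
  proof (cases "cover_edge c a \<in> ?E")
    case True
    then show ?thesis using diff_arc_trans_or_reduce[OF wT vT that True] irred by blast
  next
    case False
    have E: "cover_edge a b \<in> ?E" "cover_edge b c \<in> ?E"
      using that by (auto simp: diff_arc_def)
    have ne: "a \<noteq> b" "b \<noteq> c" "c \<noteq> a"
      using E cover_edge_self that asym by blast+
    \<comment> \<open>If \<open>a\<close> or \<open>c\<close> is \<open>0\<close>, the two given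
      arcs already show that half edges are present. Hence nonadjacency comes from a missing
      loop.\<close>
    have "c = - a" "\<Phi> \<noteq> Type_C"
      using False E ne by (auto simp: cover_edge_in_iff)
    moreover have "\<not> ?D x (- x)" for x
      using \<open>\<Phi> \<noteq> Type_C\<close> cover_edge_in_iff[of x "- x"] cover_edge_self[of x]
      by (cases "x = 0") (auto simp: diff_arc_def)
    ultimately show ?thesis by blast
  qed
  have "\<not> ?D a b" for a b
    using skew_quasi_transitive_empty[of ?D, OF fin asym diff_arc_uminus diff_arc_successor[OF w v] trans] .
  moreover obtain e where e: "e \<in> diff_edges ?E w v"
  proof -
    have "\<exists>e\<in>?E. w e \<noteq> v e"
      using \<open>w \<noteq> v\<close> wT vT unfolding tournaments_def by (meson PiE_ext)
    then show ?thesis using that by (auto simp: diff_edges_def)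
  qed
  moreover obtain a b where "a \<noteq> b" "e = cover_edge a b"
    using e by (auto simp: diff_edges_def elim: edge_is_cover_edge)
  \<comment> \<open>Whichever way \<open>w\<close> orients the differing game, the result is an arc
    of the difference digraph.\<close>
  ultimately show False
    using cover_arc_commute[OF wT, of a b] cover_edge_commute[of a b]
    unfolding diff_arc_iff[OF wT vT] diff_edges_def mem_Collect_eq by metis
qed

section \<open>Short walks, connectedness and diameter\<close>

lemma IntGr_arcI:
  "w \<in> Tour \<Phi> n s \<Longrightarrow> generator_copy \<Phi> n w X \<Longrightarrow> (w, X, 0) \<in> arcs (IntGr \<Phi> n s)"
  by (simp add: IntGr_def)

lemma IntGr_simps [simp]:
  "verts (IntGr \<Phi> n s) = Tour \<Phi> n s"
  "tail (IntGr \<Phi> n s) (w, X, m) = w"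
  "head (IntGr \<Phi> n s) (w, X, m) = flip w X"
  by (simp_all add: IntGr_def)

text \<open>Induction on the number of differing games: a flip in \<open>w\<close> prepends an arc
  to the walk, a flip in \<open>v\<close> appends one.\<close>

lemma IntGr_short_awalk:
  assumes "w \<in> Tour \<Phi> n s" "v \<in> Tour \<Phi> n s"
  shows "\<exists>p. pre_digraph.awalk (IntGr \<Phi> n s) w p v \<and> length p \<le> card (diff_edges (complete_sgraph \<Phi> n) w v)"
  using assms
proof (induction "card (diff_edges (complete_sgraph \<Phi> n) w v)" arbitrary: w v rule: less_induct)
  case less
  let ?E = "complete_sgraph \<Phi> n" and ?G = "IntGr \<Phi> n s"
  interpret pseudo_graph ?G by (rule pseudo_graph_IntGr)
  note w = less.prems(1) and v = less.prems(2)
  show ?case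
  proof (cases "w = v")
    case True
    then show ?thesis using w by (intro exI[of _ "[]"]) (simp add: awalk_Nil_iff)
  next
    case False
    then obtain X where "generator_copy \<Phi> n w X \<and> card (diff_edges ?E (flip w X) v) < card (diff_edges ?E w v)
      \<or> generator_copy \<Phi> n v X \<and> card (diff_edges ?E w (flip v X)) < card (diff_edges ?E w v)"
      using reducing_generator_exists[OF w v] by blast
    then show ?thesis
    proof (elim disjE conjE)
      assume gen: "generator_copy \<Phi> n w X"
        and less_card: "card (diff_edges ?E (flip w X) v) < card (diff_edges ?E w v)"
      have "flip w X \<in> Tour \<Phi> n s"
        using flip_in_Tour(1)[OF w] gen by (simp add: generator_copy_def)
      then obtain p where "awalk (flip w X) p v" "length p \<le> card (diff_edges ?E (flip w X) v)"
        using less.hyps[OF less_card _ v] by blast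
      then show ?thesis
        using less_card IntGr_arcI[OF w gen]
        by (intro exI[of _ "(w, X, 0) # p"]) (simp add: awalk_Cons_iff)
    next
      assume gen: "generator_copy \<Phi> n v X"
        and less_card: "card (diff_edges ?E w (flip v X)) < card (diff_edges ?E w v)"
      have X: "X \<subseteq> ?E" "neutral v X" using gen by (auto simp: generator_copy_def)
      note flipped = flip_in_Tour[OF v X]
      \<comment> \<open>The flip moves away from \<open>v\<close>, so the walk must traverse it
        backwards: the flipped games are still neutral, and flipping them again restores
        \<open>v\<close>.\<close>
      have gen': "generator_copy \<Phi> n (flip v X) X"
        using gen flipped(2) by (simp add: generator_copy_def)
      have involution: "flip (flip v X) X = v"
        using v X(1) by (intro flip_flip) (auto simp: Tour_def)
      obtain p where "awalk w p (flip v X)" "length p \<le> card (diff_edges ?E w (flip v X))"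
        using less.hyps[OF less_card w flipped(1)] by blast
      moreover have "awalk (flip v X) [(flip v X, X, 0)] v"
        using arc_implies_awalk[OF IntGr_arcI[OF flipped(1) gen']] by (simp add: involution)
      ultimately show ?thesis
        using less_card by (intro exI[of _ "p @ [(flip v X, X, 0)]"]) (auto intro: awalk_appendI)
    qed
  qed
qed

text \<open>The four kinds of edges number at most \<open>n\<^sup>2\<close>,
  \<open>n\<^sup>2\<close>, \<open>n\<close> and \<open>n\<close>, and
  \<open>n \<le> n\<^sup>2\<close>; this is the source of the constant 4.\<close>

lemma card_complete_sgraph_le: "card (complete_sgraph \<Phi> n) \<le> 4 * n\<^sup>2"
proof -
  let ?P = "{1..n} \<times> {1..n}"
  have "complete_sgraph \<Phi> n \<subseteq>
      case_prod Neg ` ?P \<union> case_prod Pos ` ?P \<union> Half ` {1..n} \<union> Loop ` {1..n}" (is "_ \<subseteq> ?S")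
    by (cases \<Phi>) (auto simp: pair_edges_def image_iff)
  then have "card (complete_sgraph \<Phi> n) \<le> card ?S"
    by (intro card_mono) auto
  also have "\<dots> \<le> card (case_prod Neg ` ?P) + card (case_prod Pos ` ?P) + card (Half ` {1..n}) + card (Loop ` {1..n})"
    by (meson add_mono card_Un_le le_refl order_trans)
  also have "\<dots> \<le> card ?P + card ?P + card {1..n} + card {1..n}"
    by (intro add_mono card_image_le) auto
  also have "\<dots> \<le> 4 * n\<^sup>2"
    using add_mono[OF le_square le_square, of n n] by (simp add: power2_eq_square)
  finally show ?thesis .
qed

lemma IntGr_connected:
  assumes "s \<in> Score \<Phi> n"
  shows "Digraph_Component.connected (IntGr \<Phi> n s)"
proof -
  interpret pseudo_graph "IntGr \<Phi> n s" by (rule pseudo_graph_IntGr)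
  \<comment> \<open>Strong connectedness includes having a vertex; a score sequence is the score of
    some tournament.\<close>
  have nonempty: "Tour \<Phi> n s \<noteq> {}"
    using assms by (auto simp: Score_def Tour_def)
  show ?thesis
    unfolding connected_def
  proof (rule strongly_connectedI)
    fix w v
    assume "w \<in> verts (with_proj (mk_symmetric (IntGr \<Phi> n s)))"
      "v \<in> verts (with_proj (mk_symmetric (IntGr \<Phi> n s)))"
    then obtain p where "awalk w p v"
      using IntGr_short_awalk[of w \<Phi> n s v] by auto
    then show "w \<rightarrow>\<^sup>*\<^bsub>mk_symmetric (IntGr \<Phi> n s)\<^esub> v"
      by (intro reachable_mk_symmetricI reachable_awalkI)
  qed (use nonempty in simp)
qed

lemma graph_diameter_IntGr_le: "graph_diameter (IntGr \<Phi> n s) \<le> ereal (4 * real n ^ 2)"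
proof -
  let ?E = "complete_sgraph \<Phi> n"
  interpret pseudo_graph "IntGr \<Phi> n s" by (rule pseudo_graph_IntGr)
  have "\<mu> (\<lambda>_. 1) w v \<le> ereal (4 * real n ^ 2)"
    if "w \<in> Tour \<Phi> n s" "v \<in> Tour \<Phi> n s" for w v
  proof -
    obtain p where p: "awalk w p v" "length p \<le> card (diff_edges ?E w v)"
      using IntGr_short_awalk[OF \<open>w \<in> _\<close> \<open>v \<in> _\<close>] by blast
    note p(2)
    also have "card (diff_edges ?E w v) \<le> card ?E"
      by (intro card_mono finite_complete_sgraph) (auto simp: diff_edges_def)
    also note card_complete_sgraph_le
    finally have "real (length p) \<le> 4 * real n ^ 2"
      by (metis of_nat_le_iff of_nat_mult of_nat_numeral of_nat_power)
    moreover have "awalk_cost (\<lambda>_. 1) p = real (length p)"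
      by (simp add: awalk_cost_def sum_list_triv)
    ultimately show ?thesis
      using min_cost_le_walk_cost[OF p(1), of "\<lambda>_. 1"] order_trans by fastforce
  qed
  then show ?thesis
    unfolding graph_diameter_def by (intro SUP_least) simp
qed

theorem theorem5:
  shows "(\<forall>\<Phi> n s. s \<in> Score \<Phi> n \<longrightarrow> Digraph_Component.connected (IntGr \<Phi> n s)) \<and>
    (\<exists>c :: real. \<forall>\<Phi> n s. s \<in> Score \<Phi> n \<longrightarrow> graph_diameter (IntGr \<Phi> n s) \<le> ereal (c * real n ^ 2))"
  using IntGr_connected graph_diameter_IntGr_le by blast

end
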